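(* Let $a,b,c>0$, $\Delta t>0$, $\mathbf{A}=\begin{pmatrix}-ac & bc\\ a&-b\end{pmatrix}$, and let $\mathbf{g}\colon\mathbb{R}^2_{>0}\to\mathbb{R}^2_{>0}$ be the map generating the GeCo2 iterates $\mathbf{y}^{n+1}=\mathbf{g}(\mathbf{y}^n)$ when applied to $\mathbf{y}'=\mathbf{A}\mathbf{y}$ (defined in the context). Let $\mathbf{y}^*>\mathbf{0}$ be a steady state, i.e. $\mathbf{y}^*\in\ker(\mathbf{A})\cap\mathbb{R}^2_{>0}$. Then $\mathbf{g}$ is in $\mathcal{C}^1(\mathcal{D})$ and has Lipschitz continuous first derivatives on a sufficiently small neighborhood $\mathcal{D}$ of $\mathbf{y}^*$. Moreover, the stability function of the GeCo2 scheme is $$R(z)=1+z+\tfrac12 z^2\varphi(\Delta t\operatorname{trace}(\mathbf{S}^-)),\qquad \operatorname{trace}(\mathbf{S}^-)=ac+b.$$ If $|R(-\Delta t(ac+b))|<1$, then $\mathbf{y}^*$ is a stable fixed point of $\mathbf g$ and there exists a $\delta>0$ such that $(1,c)\mathbf{y}^0=(1,c)\mathbf{y}^*$ and $\|\mathbf{y}^0-\mathbf{y}^*\|<\delta$ imply $\lim_{n\to\infty}\mathbf{y}^n=\mathbf{y}^*$. If $|R(-\Delta t(ac+b))|>1$, then $\mathbf{y}^*$ is an unstable fixed point of GeCo2.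
   Context: Let $\varphi(x)=\frac{1-e^{-x}}{x}$ for $x>0$ and $\varphi(0)=1$. Write $\mathbf{A}=\mathbf{S}^+-\mathbf{S}^-$ with $\mathbf{S}^-=\operatorname{diag}(ac,b)$, so $\operatorname{trace}(\mathbf{S}^-)=ac+b$. The GeCo2 map for $\mathbf{y}'=\mathbf{A}\mathbf{y}$ is, for $\mathbf{x}\in\mathbb{R}^2_{>0}$, $$\mathbf{g}(\mathbf{x})=\mathbf{x}+\tfrac12\Delta t\,\varphi\!\left(\Delta t\left(\frac{w_1^+(\mathbf{x})}{x_1}+\frac{w_2^+(\mathbf{x})}{x_2}\right)\right)\mathbf{A}\bigl(2\mathbf{x}+\Delta t\,\varphi(\Delta t\operatorname{trace}(\mathbf{S}^-))\mathbf{A}\mathbf{x}\bigr),$$ where $w_i^+=\max(0,w_i)$ and $$\mathbf{w}(\mathbf{x})=\bigl(2\varphi(\Delta t\operatorname{trace}(\mathbf{S}^-))\mathbf{A}-2\mathbf{A}-\Delta t\,\varphi(\Delta t\operatorname{trace}(\mathbf{S}^-))\mathbf{A}^2\bigr)\mathbf{x}.$$ The GeCo2 scheme is known to preserve positivity and the linear invariant $y_1+cy_2$. The eigenvalues of $\mathbf{A}$ are $0$ and $\lambda=-(ac+b)$. That $R$ is the stability function of the scheme means that the eigenvalues of the Jacobian $\mathbf{D}\mathbf{g}(\mathbf{y}^* )$ are $1$ and $R(\Delta t\lambda)=R(-\Delta t(ac+b))$. A fixed point $\mathbf{y}^*$ of $\mathbf{y}^{n+1}=\mathbf{g}(\mathbf{y}^n)$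 is stable if for any $\epsilon>0$ there is $\delta>0$ such that $\|\mathbf{y}^0-\mathbf{y}^*\|<\delta$ implies $\|\mathbf{y}^n-\mathbf{y}^*\|<\epsilon$ for all $n\ge0$; it is unstable if it is not stable. *)

theory Defs
  imports "HOL-Analysis.Analysis"
begin

(* Only used for x >= 0. *)
definition phi :: "real \<Rightarrow> real" where
  "phi x = (if x = 0 then 1 else (1 - exp (- x)) / x)"

definition pos_quadrant :: "(real^2) set" where
  "pos_quadrant = {x. \<forall>i. 0 < x $ i}"

definition A_mat :: "real \<Rightarrow> real \<Rightarrow> real \<Rightarrow> real^2^2" where
  "A_mat a b c = vector [vector [- (a * c), b * c], vector [a, - b]]"

(* The destruction part in the splitting A = S^+ - S^-, where
   S^+ = vector [vector [0, b * c], vector [a, 0]]. *)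
definition S_minus :: "real \<Rightarrow> real \<Rightarrow> real \<Rightarrow> real^2^2" where
  "S_minus a b c = vector [vector [a * c, 0], vector [0, b]]"

definition geco2_w :: "real^2^2 \<Rightarrow> real^2^2 \<Rightarrow> real \<Rightarrow> real^2 \<Rightarrow> real^2" where
  "geco2_w A S dt x =
     (2 * phi (dt * trace S)) *\<^sub>R (A *v x) - 2 *\<^sub>R (A *v x)
       - (dt * phi (dt * trace S)) *\<^sub>R ((A ** A) *v x)"

(* One step of GeCo2 for y' = A y with destruction matrix S. The map is a total function;
   only its values on pos_quadrant are meaningful. *)
definition geco2_step :: "real^2^2 \<Rightarrow> real^2^2 \<Rightarrow> real \<Rightarrow> real^2 \<Rightarrow> real^2" where
  "geco2_step A S dt x =
     x + (1/2 * dt * phi (dt * (max 0 (geco2_w A S dt x $ 1) / x $ 1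
                              + max 0 (geco2_w A S dt x $ 2) / x $ 2)))
         *\<^sub>R (A *v (2 *\<^sub>R x + (dt * phi (dt * trace S)) *\<^sub>R (A *v x)))"

definition geco2 :: "real \<Rightarrow> real \<Rightarrow> real \<Rightarrow> real \<Rightarrow> real^2 \<Rightarrow> real^2" where
  "geco2 a b c dt = geco2_step (A_mat a b c) (S_minus a b c) dt"

definition geco2_R :: "real \<Rightarrow> real \<Rightarrow> real \<Rightarrow> real \<Rightarrow> real \<Rightarrow> real" where
  "geco2_R a b c dt z = 1 + z + 1/2 * z\<^sup>2 * phi (dt * trace (S_minus a b c))"

(* All complex eigenvalues of a real matrix. *)
definition eigenvalues :: "real^'n^'n \<Rightarrow> complex set" where
  "eigenvalues M = {\<mu>. \<exists>v. v \<noteq> 0 \<and> map_matrix complex_of_real M *v v = \<mu> *s v}"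

(* Intended for open D. *)
definition C1_on :: "(real^'n \<Rightarrow> real^'m) \<Rightarrow> (real^'n) set \<Rightarrow> bool" where
  "C1_on f D \<longleftrightarrow> (\<forall>x\<in>D. f differentiable (at x)) \<and> continuous_on D (\<lambda>x. jacobian f (at x))"

(* Stability for y^(n+1) = f (y^n) with initial values taken from the domain X of f. *)
definition stable_fixed_point ::
  "('a::real_normed_vector \<Rightarrow> 'a) \<Rightarrow> 'a set \<Rightarrow> 'a \<Rightarrow> bool" where
  "stable_fixed_point f X p \<longleftrightarrow> p \<in> X \<and> f p = p \<and>
     (\<forall>\<epsilon>>0. \<exists>\<delta>>0. \<forall>y\<in>X. norm (y - p) < \<delta> \<longrightarrow> (\<forall>n. norm ((f ^^ n) y - p) < \<epsilon>))"

definition unstable_fixed_point ::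
  "('a::real_normed_vector \<Rightarrow> 'a) \<Rightarrow> 'a set \<Rightarrow> 'a \<Rightarrow> bool" where
  "unstable_fixed_point f X p \<longleftrightarrow> p \<in> X \<and> f p = p \<and> \<not> stable_fixed_point f X p"

end

theory Submission
  imports Defs
begin

text \<open>
  Since \<open>A x = u(x) v\<close> with \<open>u(x) = a x\<^sub>1 - b x\<^sub>2\<close> and \<open>v = (- c, 1)\<close>, the scheme is
  \<open>g(x) = x + M h(x) u(x) v\<close> with a constant \<open>M\<close> and the nonsmooth factor \<open>h\<close> coming from the
  outer \<open>\<phi>\<close>. Because \<open>t \<phi>(t) = 1 - exp (- t)\<close>, the product \<open>h u\<close> is a combination of
  perspectives \<open>y G(k u / y)\<close> of a scalar function \<open>G\<close> that vanishes on the negative half-line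
  and has a Lipschitz derivative with \<open>G'(0) = 0\<close>; this gives the regularity and the Jacobian
  \<open>I + M A\<close> at a steady state.

  No centre manifold argument is needed: \<open>x\<^sub>1 + c x\<^sub>2\<close> is invariant and
  \<open>u(g(x)) = (1 - (a c + b) M h(x)) u(x)\<close>, where the factor is continuous at the steady state and
  equals the stability function there. In the coordinates \<open>(x\<^sub>1 + c x\<^sub>2, u(x))\<close> the iteration is
  therefore a scalar contraction or expansion of \<open>u\<close>.
\<close>

section \<open>The function \<open>phi\<close> and its nonsmooth companion
  \<open>ramp\<close>\<close>

lemma mult_phi: "x * phi x = 1 - exp (- x)"
  by (simp add: phi_def)

text \<open>The value 1 is the derivative of \<open>1 - exp (- x)\<close> at 0. At a steady state
  the outer \<open>phi\<close> is evaluated exactly at 0, so this continuity controls the growth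
  factor nearby.\<close>

lemma isCont_phi_0: "isCont phi 0"
proof -
  have "((\<lambda>x::real. 1 - exp (- x)) has_real_derivative 1) (at 0)"
    by (auto intro!: derivative_eq_intros)
  then have "((\<lambda>x::real. (1 - exp (- x)) / x) \<longlongrightarrow> 1) (at 0)"
    by (simp add: has_field_derivative_iff)
  moreover have "\<forall>\<^sub>F x in at 0. (1 - exp (- x)) / x = phi x"
    by (auto simp: eventually_at_filter phi_def)
  ultimately have "(phi \<longlongrightarrow> 1) (at 0)"
    by (rule Lim_transform_eventually)
  then show ?thesis
    by (simp add: isCont_def phi_def)
qed

text \<open>This is \<open>tanh (s / 2) < s / 2\<close> with denominators cleared. The difference of
  the two sides vanishes at 0 and has derivative \<open>1 - exp (- x) * (1 + x)\<close>, positive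
  since \<open>1 + x < exp x\<close>. It fixes the sign of \<open>kappa\<close>.\<close>

lemma two_minus_exp_less:
  fixes s :: real
  assumes "0 < s"
  shows "2 - 2 * exp (- s) < s + s * exp (- s)"
proof -
  have "\<exists>y. ((\<lambda>x. x + x * exp (- x) - (2 - 2 * exp (- x))) has_real_derivative y) (at x) \<and> 0 < y"
    if "0 < x" for x :: real
  proof (intro exI conjI)
    show "((\<lambda>x. x + x * exp (- x) - (2 - 2 * exp (- x))) has_real_derivative
        1 - exp (- x) * (1 + x)) (at x)"
      by (auto intro!: derivative_eq_intros simp: algebra_simps)
    have "1 + x < exp x"
      using ln_add_one_self_less_self[OF that] that by (metis add_pos_pos exp_less_mono exp_ln zero_less_one)
    then have "exp (- x) * (1 + x) < exp (- x) * exp x"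
      by simp
    then show "0 < 1 - exp (- x) * (1 + x)"
      by (simp flip: exp_add)
  qed
  then have "(\<lambda>x. x + x * exp (- x) - (2 - 2 * exp (- x))) 0
      < (\<lambda>x::real. x + x * exp (- x) - (2 - 2 * exp (- x))) s"
    using assms
    by (intro DERIV_pos_imp_increasing_open[OF assms]) (auto intro!: continuous_intros)
  then show ?thesis
    by simp
qed

text \<open>For \<open>t > 0\<close> this is \<open>r * (phi (t * r) - 1)\<close> on
  \<open>r \<ge> 0\<close> and zero on \<open>r \<le> 0\<close>: the function \<open>G\<close> of
  the overview.\<close>

definition ramp :: "real \<Rightarrow> real \<Rightarrow> real" where
  "ramp t r = (1 - exp (- (t * max 0 r))) / t - max 0 r"

definition ramp' :: "real \<Rightarrow> real \<Rightarrow> real" where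
  "ramp' t r = exp (- (t * max 0 r)) - 1"

lemma ramp_0 [simp]: "ramp t 0 = 0" "ramp' t 0 = 0"
  by (simp_all add: ramp_def ramp'_def)

lemma has_real_derivative_ramp:
  assumes "0 < t"
  shows "(ramp t has_real_derivative ramp' t r) (at r)"
proof -
  define H where "H x = (1 - exp (- (t * x))) / t - x" for x
  have H: "(H has_real_derivative exp (- (t * x)) - 1) (at x)" for x
    unfolding H_def using assms by (auto intro!: derivative_eq_intros)
  consider "r < 0" | "r > 0" | "r = 0" by linarith
  then show ?thesis
  proof cases
    case 1
    have "((\<lambda>_. 0) has_real_derivative 0) (at r)" by simp
    then have "(ramp t has_real_derivative 0) (at r)"
      by (rule DERIV_cong_ev[THEN iffD1, rotated -1])
         (use 1 in \<open>auto simp: ramp_def intro!: eventually_mono[OF eventually_nhds_in_open[of "{..<0}"]]\<close>)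
    then show ?thesis using 1 by (simp add: ramp'_def)
  next
    case 2
    have "(ramp t has_real_derivative exp (- (t * r)) - 1) (at r)"
      by (rule DERIV_cong_ev[THEN iffD1, rotated -1, OF H])
         (use 2 in \<open>auto simp: ramp_def H_def intro!: eventually_mono[OF eventually_nhds_in_open[of "{0<..}"]]\<close>)
    then show ?thesis using 2 by (simp add: ramp'_def)
  next
    case 3
    have "((\<lambda>x. H x / x) \<longlongrightarrow> 0) (at 0)"
      using H[of 0] by (simp add: has_field_derivative_iff H_def)
    \<comment> \<open>\<open>ramp\<close> agrees with the smooth \<open>H\<close> to the right of 0
      and is zero to the left, so its difference quotient at 0 is dominated by that of
      \<open>H\<close>, which tends to 0.\<close>
    then have "((\<lambda>x. ramp t x / x) \<longlongrightarrow> 0) (at 0)"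
      by (rule Lim_null_comparison[rotated, OF tendsto_rabs_zero])
         (auto simp: ramp_def H_def max_def divide_le_0_iff)
    then show ?thesis using 3 by (simp add: has_field_derivative_iff)
  qed
qed

section \<open>Lipschitz estimates and perspectives of \<open>ramp\<close>\<close>

lemma lipschitz_on_atLeast_0_if_deriv_le:
  fixes f f' :: "real \<Rightarrow> real"
  assumes "\<And>x. x \<ge> 0 \<Longrightarrow> (f has_real_derivative f' x) (at x)"
    and "\<And>x. x \<ge> 0 \<Longrightarrow> \<bar>f' x\<bar> \<le> L"
  shows "L-lipschitz_on {0..} f"
proof (rule bounded_derivative_imp_lipschitz[where f' = "\<lambda>x. (*) (f' x)"])
  show "(f has_derivative (*) (f' x)) (at x within {0..})" if "x \<in> {0..}" for x
    using assms(1)[of x] that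
    by (auto simp: has_field_derivative_def intro: has_derivative_at_withinI)
  show "onorm ((*) (f' x)) \<le> L" if "x \<in> {0..}" for x
    using assms(2)[of x] that by (intro onorm_le) (auto simp: abs_mult intro: mult_right_mono)
  show "0 \<le> L" using assms(2)[of 0] by auto
qed auto

lemma lipschitz_on_max_0: "1-lipschitz_on UNIV (\<lambda>x::real. max 0 x)"
  by (rule lipschitz_onI) (auto simp: dist_real_def)

text \<open>Clamping is nonexpansive, so a bound obtained on the half-line, where the formulas for
  \<open>ramp\<close> are smooth, transfers to the whole line with the same constant.\<close>

lemma lipschitz_on_comp_max_0:
  fixes f :: "real \<Rightarrow> real"
  assumes "L-lipschitz_on {0..} f"
  shows "L-lipschitz_on UNIV (\<lambda>x. f (max 0 x))"
proof -
  have "range (max (0::real)) \<subseteq> {0..}" by auto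
  from lipschitz_on_compose2[OF lipschitz_on_max_0 lipschitz_on_subset[OF assms this]]
  show ?thesis by simp
qed

lemma lipschitz_on_ramp':
  assumes "0 < t"
  shows "t-lipschitz_on UNIV (ramp' t)"
proof -
  have "t-lipschitz_on {0..} (\<lambda>x. exp (- (t * x)) - 1)"
  proof (rule lipschitz_on_atLeast_0_if_deriv_le[where f' = "\<lambda>x. - (t * exp (- (t * x)))"])
    show "((\<lambda>x. exp (- (t * x)) - 1) has_real_derivative - (t * exp (- (t * x)))) (at x)" for x
      by (auto intro!: derivative_eq_intros)
    show "\<bar>- (t * exp (- (t * x)))\<bar> \<le> t" if "0 \<le> x" for x
      using that assms by (simp add: abs_mult)
  qed
  from lipschitz_on_comp_max_0[OF this] show ?thesis
    by (simp add: ramp'_def[abs_def])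
qed

text \<open>The combination \<open>G(r) - r G'(r)\<close> is the derivative of the perspective \<open>y G(u / y)\<close> in \<open>y\<close>.\<close>

lemma lipschitz_on_ramp_Legendre:
  assumes "0 < t"
  shows "1-lipschitz_on UNIV (\<lambda>r. ramp t r - r * ramp' t r)"
proof -
  have "1-lipschitz_on {0..} (\<lambda>x. (1 - exp (- (t * x))) / t - x * exp (- (t * x)))"
  proof (rule lipschitz_on_atLeast_0_if_deriv_le[where f' = "\<lambda>x. t * x * exp (- (t * x))"])
    show "((\<lambda>x. (1 - exp (- (t * x))) / t - x * exp (- (t * x))) has_real_derivative
        t * x * exp (- (t * x))) (at x)" for x
      using assms by (auto intro!: derivative_eq_intros)
    fix x :: real assume "0 \<le> x"
    have "t * x * exp (- (t * x)) \<le> exp (t * x) * exp (- (t * x))"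
      by (intro mult_right_mono) (use exp_ge_add_one_self[of "t * x"] in linarith, simp)
    then show "\<bar>t * x * exp (- (t * x))\<bar> \<le> 1"
      using \<open>0 \<le> x\<close> assms by (simp flip: exp_add)
  qed
  note lipschitz_on_comp_max_0[OF this]
  moreover have "ramp t r - r * ramp' t r
      = (1 - exp (- (t * max 0 r))) / t - max 0 r * exp (- (t * max 0 r))" for r
    by (cases "r \<ge> 0") (auto simp: ramp_def ramp'_def max_def algebra_simps)
  ultimately show ?thesis
    by simp
qed

lemma lipschitz_on_divide_nth:
  fixes X :: "(real^'n) set"
  assumes "0 < m" "\<And>x i. x \<in> X \<Longrightarrow> m \<le> x $ i" "\<And>x i. x \<in> X \<Longrightarrow> x $ i \<le> B" "0 \<le> B"
  shows "(2 * B / m\<^sup>2)-lipschitz_on X (\<lambda>x. x $ i / x $ j)"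
proof (rule lipschitz_onI)
  fix x y assume "x \<in> X" "y \<in> X"
  then have *: "m \<le> x $ k" "x $ k \<le> B" "m \<le> y $ k" "y $ k \<le> B" for k
    using assms by auto
  have **: "0 < x $ k" "0 < y $ k" for k
    using *[of k] assms(1) by auto
  have d: "\<bar>x $ k - y $ k\<bar> \<le> dist x y" for k
    by (metis component_le_norm_cart dist_norm real_norm_def vector_minus_component)
  \<comment> \<open>The product \<open>y $ i * y $ j\<close> is added and subtracted in the
    numerator, so that each summand contains one coordinate difference.\<close>
  have "x $ i / x $ j - y $ i / y $ j
      = ((x $ i - y $ i) * y $ j + y $ i * (y $ j - x $ j)) / (x $ j * y $ j)"
    using **[of j] by (simp add: field_simps)
  also have "\<bar>\<dots>\<bar> \<le> (dist x y * B + B * dist x y) / m\<^sup>2"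
    unfolding abs_divide
  proof (rule frac_le)
    show "\<bar>(x $ i - y $ i) * y $ j + y $ i * (y $ j - x $ j)\<bar> \<le> dist x y * B + B * dist x y"
      using d[of i] d[of j] *[of j] *[of i] **[of i] **[of j] assms(4)
      by (intro order_trans[OF abs_triangle_ineq] add_mono)
         (auto simp: abs_mult abs_minus_commute intro!: mult_mono)
    show "m\<^sup>2 \<le> \<bar>x $ j * y $ j\<bar>"
      using *[of j] **[of j] assms(1) by (auto simp: power2_eq_square abs_mult intro!: mult_mono)
  qed (use assms in auto)
  finally show "dist (x $ i / x $ j) (y $ i / y $ j) \<le> 2 * B / m\<^sup>2 * dist x y"
    by (simp add: dist_real_def algebra_simps)
qed (use assms in auto)

lemma lipschitz_on_scaleR_left:
  fixes f :: "'a::metric_space \<Rightarrow> real" and C :: "'b::real_normed_vector"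
  assumes "L-lipschitz_on X f"
  shows "(L * norm C)-lipschitz_on X (\<lambda>x. f x *\<^sub>R C)"
proof (rule lipschitz_onI)
  fix x y assume "x \<in> X" "y \<in> X"
  have "dist (f x *\<^sub>R C) (f y *\<^sub>R C) = dist (f x) (f y) * norm C"
    by (simp add: dist_norm flip: scaleR_left_diff_distrib)
  also have "\<dots> \<le> L * dist x y * norm C"
    using lipschitz_onD[OF assms \<open>x \<in> X\<close> \<open>y \<in> X\<close>] by (intro mult_right_mono) auto
  finally show "dist (f x *\<^sub>R C) (f y *\<^sub>R C) \<le> L * norm C * dist x y"
    by (simp add: mult_ac)
qed (use lipschitz_on_nonneg[OF assms] in auto)

text \<open>For \<open>r = k * u / y > 0\<close> the factor \<open>u\<close> cancels the denominator
  of \<open>phi\<close>; otherwise \<open>phi 0 = 1\<close> and \<open>ramp\<close> vanishes. The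
  kink of the maximum thus enters only through the differentiable function
  \<open>ramp\<close>.\<close>

lemma phi_max_ramp:
  assumes "0 < t" "0 < y" "k \<noteq> 0"
  shows "u * phi (t * (max 0 (k * u) / y)) = u + y / k * ramp t (k * u / y)"
proof (cases "0 < k * u")
  case True
  then have "u \<noteq> 0" "0 < k * u / y" using assms by auto
  then show ?thesis
    using True assms by (simp add: phi_def ramp_def field_simps)
next
  case False
  then have "k * u / y \<le> 0" using assms by (simp add: divide_le_0_iff)
  then show ?thesis
    using False by (simp add: phi_def ramp_def max_def)
qed

text \<open>The coefficients of \<open>u'\<close> and \<open>y'\<close> depend on the point only
  through the ratio \<open>r\<close>. Lipschitz continuity of the Jacobian therefore reduces to
  scalar functions of \<open>r\<close>.\<close>

lemma has_derivative_ramp_perspective: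
  fixes u y :: "'a::real_normed_vector \<Rightarrow> real"
  assumes t: "0 < t" and "k \<noteq> 0" "y x \<noteq> 0"
    and [derivative_intros]: "(u has_derivative u') (at x)" "(y has_derivative y') (at x)"
  defines "r \<equiv> k * u x / y x"
  shows "((\<lambda>x. y x / k * ramp t (k * u x / y x)) has_derivative
    (\<lambda>h. ramp' t r * u' h + (ramp t r - r * ramp' t r) / k * y' h)) (at x)"
proof -
  have "((\<lambda>x. k * u x / y x) has_derivative
      (\<lambda>h. k * u' h / y x - k * u x * y' h / (y x)\<^sup>2)) (at x)"
    using assms(2,3)
    by (auto intro!: derivative_eq_intros simp: field_simps power2_eq_square)
  note DERIV_compose_FDERIV[OF has_real_derivative_ramp[OF t] this, derivative_intros]
  show ?thesis
    using assms(2,3) unfolding r_def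
    by (auto intro!: derivative_eq_intros simp: field_simps power2_eq_square)
qed

section \<open>The scheme in terms of the residual\<close>

locale geco2_params =
  fixes a b c dt :: real
  assumes a_pos: "0 < a" and b_pos: "0 < b" and c_pos: "0 < c" and dt_pos: "0 < dt"
begin

definition trS :: real where
  "trS = a * c + b"

definition resid :: "real^2 \<Rightarrow> real" where
  "resid x = a * x $ 1 - b * x $ 2"

definition inv_lin :: "real^2 \<Rightarrow> real" where
  "inv_lin x = x $ 1 + c * x $ 2"

definition dir :: "real^2" where
  "dir = vector [- c, 1]"

text \<open>As \<open>dir\<close> is an eigenvector of \<open>A\<close> for the eigenvalue
  \<open>- trS\<close>, the vector \<open>w\<close> of the scheme is \<open>kappa * resid x\<close>
  times \<open>dir\<close>.\<close>

definition kappa :: real where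
  "kappa = 2 * phi (dt * trS) - 2 + dt * phi (dt * trS) * trS"

text \<open>The constant \<open>M\<close> of the overview; by \<open>mult_phi\<close> it equals
  \<open>dt * (1 + exp (- (dt * trS))) / 2\<close>.\<close>

definition slope :: real where
  "slope = dt * (1 - dt * phi (dt * trS) * trS / 2)"

text \<open>The outer \<open>phi\<close> factor of the scheme, called \<open>h\<close> in the
  overview, with the two entries of \<open>w\<close> inserted.\<close>

definition damp :: "real^2 \<Rightarrow> real" where
  "damp x = phi (dt * (max 0 (- (c * kappa) * resid x) / x $ 1 + max 0 (kappa * resid x) / x $ 2))"

lemma dir_nth: "dir $ 1 = - c" "dir $ 2 = 1"
  by (simp_all add: dir_def)

lemma trS_pos: "0 < trS"
  using a_pos b_pos c_pos by (simp add: trS_def add_pos_pos)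

lemma trace_S_minus: "trace (S_minus a b c) = trS"
  by (simp add: trace_def sum_2 S_minus_def trS_def)

lemma resid_simps:
  "resid (x + y) = resid x + resid y" "resid (x - y) = resid x - resid y"
  "resid (k *\<^sub>R x) = k * resid x" "resid dir = - trS"
  by (simp_all add: resid_def dir_def trS_def algebra_simps)

lemma inv_lin_simps:
  "inv_lin (x + y) = inv_lin x + inv_lin y" "inv_lin (x - y) = inv_lin x - inv_lin y"
  "inv_lin (k *\<^sub>R x) = k * inv_lin x" "inv_lin dir = 0"
  by (simp_all add: inv_lin_def dir_def algebra_simps)

lemma A_mat_mult: "A_mat a b c *v x = resid x *\<^sub>R dir"
  by (simp add: vec_eq_iff forall_2 matrix_vector_mult_def sum_2 A_mat_def resid_def dir_def algebra_simps)

lemma geco2_w_eq: "geco2_w (A_mat a b c) (S_minus a b c) dt x = (kappa * resid x) *\<^sub>R dir"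
  by (simp add: geco2_w_def trace_S_minus kappa_def A_mat_mult resid_simps
      flip: matrix_vector_mul_assoc) (simp add: algebra_simps)

lemma geco2_eq: "geco2 a b c dt x = x + (slope * damp x * resid x) *\<^sub>R dir"
  unfolding geco2_def geco2_step_def geco2_w_eq
  by (simp add: trace_S_minus A_mat_mult resid_simps damp_def slope_def dir_nth mult_ac)
     (simp add: algebra_simps)

text \<open>Multiplication by \<open>s = dt * trS\<close> turns every \<open>s * phi s\<close> into
  \<open>1 - exp (- s)\<close> and leaves exactly \<open>two_minus_exp_less\<close>. In particular,
  divisions by \<open>kappa\<close> are legitimate.\<close>

lemma kappa_neg: "kappa < 0"
proof -
  define s where "s = dt * trS"
  have "0 < s" using dt_pos trS_pos by (simp add: s_def)
  have "s * kappa = 2 * (s * phi s) - 2 * s + s * (s * phi s)"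
    by (simp add: kappa_def s_def algebra_simps)
  also have "\<dots> = (2 - 2 * exp (- s)) - (s + s * exp (- s))"
    by (simp add: mult_phi algebra_simps)
  also have "\<dots> < 0"
    using two_minus_exp_less[OF \<open>0 < s\<close>] by simp
  finally show ?thesis
    using \<open>0 < s\<close> by (simp add: mult_less_0_iff)
qed

text \<open>The entries of \<open>dir\<close> have opposite signs, so at most one of the two maxima
  in \<open>damp\<close> is positive. Then \<open>phi\<close> of their sum is \<open>phi\<close> of
  that single term, and the \<open>ramp\<close> belonging to the other one vanishes.\<close>

lemma damp_resid_eq:
  assumes "x \<in> pos_quadrant"
  shows "damp x * resid x = resid x
    + x $ 1 / - (c * kappa) * ramp dt (- (c * kappa) * resid x / x $ 1)
    + x $ 2 / kappa * ramp dt (kappa * resid x / x $ 2)"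
proof -
  have x: "0 < x $ 1" "0 < x $ 2" using assms by (auto simp: pos_quadrant_def)
  have k: "kappa \<noteq> 0" "- (c * kappa) \<noteq> 0" using kappa_neg c_pos by auto
  note E = phi_max_ramp[OF dt_pos x(1) k(2), of "resid x"] phi_max_ramp[OF dt_pos x(2) k(1), of "resid x"]
  show ?thesis
  proof (cases "0 \<le> kappa * resid x")
    case True
    then have *: "- (c * kappa) * resid x \<le> 0"
      using mult_nonneg_nonneg[of c "kappa * resid x"] c_pos by (simp add: mult.assoc)
    then have "max 0 (- (c * kappa) * resid x) = 0" "phi 0 = 1"
      by (auto simp: phi_def)
    then show ?thesis using E by (simp add: damp_def mult.commute)
  next
    case False
    then have "max 0 (kappa * resid x) = 0" "phi 0 = 1"
      by (auto simp: phi_def)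
    then show ?thesis using E by (simp add: damp_def mult.commute)
  qed
qed

section \<open>The Jacobian and its Lipschitz continuity\<close>

definition geco2_jac :: "real^2 \<Rightarrow> real^2^2" where
  "geco2_jac x =
    (let r1 = - (c * kappa) * resid x / x $ 1; r2 = kappa * resid x / x $ 2 in
      mat 1 + (slope * (1 + ramp' dt r1 + ramp' dt r2)) *\<^sub>R A_mat a b c
      + (slope / - (c * kappa) * (ramp dt r1 - r1 * ramp' dt r1)) *\<^sub>R vector [vector [- c, 0], vector [1, 0]]
      + (slope / kappa * (ramp dt r2 - r2 * ramp' dt r2)) *\<^sub>R vector [vector [0, - c], vector [0, 1]])"

lemma open_pos_quadrant: "open pos_quadrant"
proof -
  have eq: "pos_quadrant = (\<Inter>i. {x. 0 < x $ i})"
    by (auto simp: pos_quadrant_def)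
  show ?thesis
    unfolding eq by (intro open_INT ballI finite_class.finite open_Collect_less continuous_intros)
qed

lemma has_derivative_geco2:
  assumes "x \<in> pos_quadrant"
  shows "(geco2 a b c dt has_derivative (*v) (geco2_jac x)) (at x)"
proof -
  have x: "x $ 1 \<noteq> 0" "x $ 2 \<noteq> 0" using assms by (auto simp: pos_quadrant_def less_le)
  have k: "kappa \<noteq> 0" "- (c * kappa) \<noteq> 0" using kappa_neg c_pos by auto
  have nth [derivative_intros]: "((\<lambda>x. x $ i) has_derivative (\<lambda>h. h $ i)) (at x)" for i
    by (rule bounded_linear_imp_has_derivative[OF bounded_linear_vec_nth])
  have resid': "(resid has_derivative resid) (at x)"
    unfolding resid_def[abs_def] by (auto intro!: derivative_eq_intros)
  let ?g = "\<lambda>x. x + (slope * (resid x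
    + x $ 1 / - (c * kappa) * ramp dt (- (c * kappa) * resid x / x $ 1)
    + x $ 2 / kappa * ramp dt (kappa * resid x / x $ 2))) *\<^sub>R dir"
  define r1 r2 where r: "r1 = - (c * kappa) * resid x / x $ 1" "r2 = kappa * resid x / x $ 2"
  have "(?g has_derivative (\<lambda>h. h + (slope * (resid h
    + (ramp' dt r1 * resid h + (ramp dt r1 - r1 * ramp' dt r1) / - (c * kappa) * h $ 1)
    + (ramp' dt r2 * resid h + (ramp dt r2 - r2 * ramp' dt r2) / kappa * h $ 2))) *\<^sub>R dir)) (at x)"
    unfolding r
    by (intro has_derivative_add has_derivative_ident has_derivative_scaleR_left has_derivative_mult_right
        resid' has_derivative_ramp_perspective[OF dt_pos k(2) x(1) resid' nth]
        has_derivative_ramp_perspective[OF dt_pos k(1) x(2) resid' nth])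
  \<comment> \<open>The terms in \<open>resid h\<close> times \<open>dir\<close> are multiples of
    \<open>A\<close> applied to \<open>h\<close>; the remaining ones are the rank-one maps sending
    \<open>h\<close> to \<open>h $ i\<close> times \<open>dir\<close>.\<close>
  also have "(\<lambda>h. h + (slope * (resid h
    + (ramp' dt r1 * resid h + (ramp dt r1 - r1 * ramp' dt r1) / - (c * kappa) * h $ 1)
    + (ramp' dt r2 * resid h + (ramp dt r2 - r2 * ramp' dt r2) / kappa * h $ 2))) *\<^sub>R dir)
    = (*v) (geco2_jac x)"
    unfolding geco2_jac_def Let_def r[symmetric]
    by (intro ext)
       (simp add: vec_eq_iff forall_2 matrix_vector_mult_def sum_2 dir_def resid_def mat_def
          A_mat_def algebra_simps)
  finally show ?thesis
    by (rule has_derivative_transform_within_open[OF _ open_pos_quadrant assms])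
       (simp add: geco2_eq mult.assoc damp_resid_eq)
qed

lemma jacobian_geco2:
  assumes "x \<in> pos_quadrant"
  shows "jacobian (geco2 a b c dt) (at x) = geco2_jac x"
  unfolding jacobian_def frechet_derivative_at[OF has_derivative_geco2[OF assms], symmetric] by simp

lemma lipschitz_on_geco2_jac:
  assumes "0 < m" "\<And>x i. x \<in> X \<Longrightarrow> m \<le> x $ i" "\<And>x i. x \<in> X \<Longrightarrow> x $ i \<le> B" "0 \<le> B"
  shows "\<exists>L. L-lipschitz_on X geco2_jac"
proof -
  have nz: "x $ i \<noteq> 0" if "x \<in> X" for x i
    using assms(1) assms(2)[OF that, of i] by auto
  note ratio = lipschitz_on_divide_nth[OF assms]
  \<comment> \<open>Both arguments are affine in coordinate ratios:
    \<open>resid x / x $ 1 = a - b * (x $ 2 / x $ 1)\<close> and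
    \<open>resid x / x $ 2 = a * (x $ 1 / x $ 2) - b\<close>.\<close>
  note L1 = lipschitz_on_cmult_real[where a = "- (c * kappa)", OF lipschitz_on_diff[OF
      lipschitz_on_constant[of X a] lipschitz_on_cmult_real[where a = b, OF ratio[of X 2 1]]]]
  note L2 = lipschitz_on_cmult_real[where a = kappa, OF lipschitz_on_diff[OF
      lipschitz_on_cmult_real[where a = a, OF ratio[of X 1 2]] lipschitz_on_constant[of X b]]]
  obtain L1 where r1: "L1-lipschitz_on X (\<lambda>x. - (c * kappa) * resid x / x $ 1)"
    by (rule that, rule lipschitz_on_transform[OF L1]) (use nz in \<open>auto simp: resid_def field_simps\<close>)
  obtain L2 where r2: "L2-lipschitz_on X (\<lambda>x. kappa * resid x / x $ 2)"
    by (rule that, rule lipschitz_on_transform[OF L2]) (use nz in \<open>auto simp: resid_def field_simps\<close>)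
  note comp = lipschitz_on_compose2[OF _ lipschitz_on_subset[OF _ subset_UNIV]]
  note R' = comp[OF _ lipschitz_on_ramp'[OF dt_pos]] and L = comp[OF _ lipschitz_on_ramp_Legendre[OF dt_pos]]
  show ?thesis
    \<comment> \<open>Every summand is constant or a scalar Lipschitz function times a constant
      matrix, so no product of two varying factors arises.\<close>
    unfolding geco2_jac_def[abs_def] Let_def
    by (rule exI)
       (rule lipschitz_on_constant R'[OF r1] R'[OF r2] L[OF r1] L[OF r2] lipschitz_on_add
         lipschitz_on_scaleR_left lipschitz_on_cmult_real)+
qed

section \<open>Growth factor of the residual and the coordinates
  \<open>(inv_lin, resid)\<close>\<close>

lemma isCont_damp:
  assumes "x \<in> pos_quadrant" "resid x = 0"
  shows "isCont damp x"
proof -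
  have "x $ 1 \<noteq> 0" "x $ 2 \<noteq> 0" using assms by (auto simp: pos_quadrant_def less_le)
  then have "isCont (\<lambda>x. dt * (max 0 (- (c * kappa) * resid x) / x $ 1
      + max 0 (kappa * resid x) / x $ 2)) x"
    unfolding resid_def by (intro continuous_intros) auto
  \<comment> \<open>Zero residual makes the argument of \<open>phi\<close> equal to 0, which is
    where its continuity has been shown.\<close>
  from isCont_o2[OF this, of phi] show ?thesis
    using isCont_phi_0 assms(2) by (simp add: damp_def[abs_def])
qed

lemma damp_resid_0: "resid x = 0 \<Longrightarrow> damp x = 1"
  by (simp add: damp_def phi_def)

lemma geco2_R_eq: "geco2_R a b c dt (- (dt * trS)) = 1 - trS * slope"
  by (simp add: geco2_R_def trace_S_minus slope_def power2_eq_square algebra_simps)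

text \<open>Since \<open>dir\<close> has residual \<open>- trS\<close>, one step multiplies the
  residual by a scalar, exactly and not merely to first order.\<close>

lemma resid_geco2: "resid (geco2 a b c dt x) = (1 - trS * slope * damp x) * resid x"
  by (simp add: geco2_eq resid_simps algebra_simps)

lemma inv_lin_geco2: "inv_lin (geco2 a b c dt x) = inv_lin x"
  by (simp add: geco2_eq inv_lin_simps)

lemma inv_lin_funpow: "inv_lin ((geco2 a b c dt ^^ n) x) = inv_lin x"
  by (induction n) (simp_all add: inv_lin_geco2)

lemma resid_le_norm: "\<bar>resid x\<bar> \<le> (a + b) * norm x"
proof -
  have "\<bar>resid x\<bar> \<le> a * \<bar>x $ 1\<bar> + b * \<bar>x $ 2\<bar>"
    using a_pos b_pos abs_triangle_ineq4[of "a * x $ 1" "b * x $ 2"] by (simp add: resid_def abs_mult)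
  also have "\<dots> \<le> a * norm x + b * norm x"
    using a_pos b_pos by (intro add_mono mult_left_mono component_le_norm_cart) auto
  finally show ?thesis by (simp add: algebra_simps)
qed

lemma inv_lin_le_norm: "\<bar>inv_lin x\<bar> \<le> (1 + c) * norm x"
proof -
  have "\<bar>inv_lin x\<bar> \<le> \<bar>x $ 1\<bar> + c * \<bar>x $ 2\<bar>"
    using c_pos abs_triangle_ineq[of "x $ 1" "c * x $ 2"] by (simp add: inv_lin_def abs_mult)
  also have "\<dots> \<le> norm x + c * norm x"
    using c_pos by (intro add_mono mult_left_mono component_le_norm_cart) auto
  finally show ?thesis by (simp add: algebra_simps)
qed

lemma inv_lin_resid_le_norm: "\<bar>inv_lin x\<bar> + \<bar>resid x\<bar> \<le> (a + b + 1 + c) * norm x"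
  using inv_lin_le_norm[of x] resid_le_norm[of x] by (simp add: algebra_simps)

text \<open>Norm bound for the inverse of the coordinate change \<open>(inv_lin, resid)\<close>,
  whose determinant is \<open>- trS\<close>.\<close>

definition nconst :: real where
  "nconst = (a + b + 1 + c) / trS"

lemma nconst_pos: "0 < nconst"
  using trS_pos a_pos b_pos c_pos by (simp add: nconst_def)

lemma norm_le_inv_lin_resid: "norm x \<le> nconst * (\<bar>inv_lin x\<bar> + \<bar>resid x\<bar>)"
proof -
  let ?i = "inv_lin x" and ?r = "resid x"
  \<comment> \<open>Cramer's rule for recovering \<open>x\<close> from its two coordinates.\<close>
  have "trS * x $ 1 = b * ?i + c * ?r" "trS * x $ 2 = a * ?i - ?r"
    by (simp_all add: trS_def inv_lin_def resid_def algebra_simps)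
  then have "\<bar>trS * x $ 1\<bar> \<le> b * \<bar>?i\<bar> + c * \<bar>?r\<bar>" "\<bar>trS * x $ 2\<bar> \<le> a * \<bar>?i\<bar> + \<bar>?r\<bar>"
    using abs_triangle_ineq[of "b * ?i" "c * ?r"] abs_triangle_ineq4[of "a * ?i" ?r] a_pos b_pos c_pos
    by (simp_all add: abs_mult)
  then have "trS * (\<bar>x $ 1\<bar> + \<bar>x $ 2\<bar>) \<le> (a + b) * \<bar>?i\<bar> + (1 + c) * \<bar>?r\<bar>"
    using trS_pos by (simp add: abs_mult algebra_simps)
  also have "\<dots> \<le> (a + b + 1 + c) * \<bar>?i\<bar> + (a + b + 1 + c) * \<bar>?r\<bar>"
    using a_pos b_pos c_pos by (rule_tac add_mono; rule_tac mult_right_mono; simp)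
  finally have "\<bar>x $ 1\<bar> + \<bar>x $ 2\<bar> \<le> nconst * (\<bar>?i\<bar> + \<bar>?r\<bar>)"
    using trS_pos by (simp add: nconst_def field_simps)
  moreover have "norm x \<le> \<bar>x $ 1\<bar> + \<bar>x $ 2\<bar>"
    using norm_le_l1_cart[of x] by (simp add: sum_2)
  ultimately show ?thesis by simp
qed

section \<open>Spectrum at a steady state\<close>

lemma eigenvalues_steady:
  "eigenvalues (mat 1 + slope *\<^sub>R A_mat a b c) = {1, complex_of_real (1 - trS * slope)}"
proof -
  let ?C = "complex_of_real"
  let ?M = "map_matrix ?C (mat 1 + slope *\<^sub>R A_mat a b c)"
  have M: "?M *v v = \<mu> *s v \<longleftrightarrow>
      v $ 1 - ?C (c * slope) * (?C a * v $ 1 - ?C b * v $ 2) = \<mu> * v $ 1 \<and>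
      v $ 2 + ?C slope * (?C a * v $ 1 - ?C b * v $ 2) = \<mu> * v $ 2" for v \<mu>
    by (simp add: vec_eq_iff forall_2 matrix_vector_mult_def sum_2 map_matrix_def A_mat_def mat_def
        algebra_simps)
  show ?thesis
  proof (intro set_eqI iffI)
    fix \<mu> assume "\<mu> \<in> eigenvalues (mat 1 + slope *\<^sub>R A_mat a b c)"
    then obtain v where v: "v \<noteq> 0" "?M *v v = \<mu> *s v"
      by (auto simp: eigenvalues_def)
    \<comment> \<open>\<open>r\<close> and \<open>i\<close> are the complex versions of
      \<open>resid\<close> and \<open>inv_lin\<close>. These functionals are left eigenvectors of
      the matrix, so the eigenvector equation splits into two scalar ones.\<close>
    define r where "r = ?C a * v $ 1 - ?C b * v $ 2"
    define i where "i = v $ 1 + ?C c * v $ 2"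
    have e: "v $ 1 - ?C (c * slope) * r = \<mu> * v $ 1" "v $ 2 + ?C slope * r = \<mu> * v $ 2"
      using v(2) by (simp_all add: M r_def)
    have "\<mu> * i = i"
      unfolding i_def distrib_left mult.left_commute[of \<mu>] e[symmetric] by (simp add: algebra_simps)
    moreover have "\<mu> * r = ?C (1 - trS * slope) * r"
    proof -
      have "\<mu> * r = ?C a * (\<mu> * v $ 1) - ?C b * (\<mu> * v $ 2)"
        by (simp add: r_def algebra_simps)
      also have "\<dots> = r - ?C (trS * slope) * r"
        unfolding e[symmetric] by (simp add: r_def trS_def algebra_simps)
      finally show ?thesis by (simp add: algebra_simps)
    qed
    \<comment> \<open>Together they determine \<open>v\<close>; whichever is nonzero can be
      cancelled and forces the value of \<mu>.\<close>
    moreover have "r \<noteq> 0 \<or> i \<noteq> 0"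
    proof (rule ccontr)
      assume "\<not> (r \<noteq> 0 \<or> i \<noteq> 0)"
      then have "?C a * v $ 1 = ?C b * v $ 2" "v $ 1 = - (?C c * v $ 2)"
        by (simp_all add: r_def i_def eq_neg_iff_add_eq_0)
      moreover from this(2) have "?C trS * v $ 2 = ?C b * v $ 2 - ?C a * v $ 1"
        by (simp add: trS_def algebra_simps)
      ultimately have "v = 0"
        using trS_pos by (simp add: vec_eq_iff forall_2)
      with v(1) show False ..
    qed
    ultimately show "\<mu> \<in> {1, ?C (1 - trS * slope)}" by auto
  next
    fix \<mu> assume "\<mu> \<in> {1, ?C (1 - trS * slope)}"
    then show "\<mu> \<in> eigenvalues (mat 1 + slope *\<^sub>R A_mat a b c)"
    proof (elim insertE emptyE)
      assume \<mu>: "\<mu> = 1"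
      \<comment> \<open>The witnesses are a kernel vector of \<open>A\<close> here and the complex
        copy of \<open>dir\<close> in the next case.\<close>
      let ?v = "vector [?C b, ?C a] :: complex^2"
      have "?v \<noteq> 0" using a_pos by (simp add: vec_eq_iff forall_2)
      moreover have "?M *v ?v = \<mu> *s ?v" unfolding M \<mu> by simp
      ultimately show ?thesis unfolding eigenvalues_def by blast
    next
      assume \<mu>: "\<mu> = ?C (1 - trS * slope)"
      let ?v = "vector [- ?C c, 1] :: complex^2"
      have "?v \<noteq> 0" by (simp add: vec_eq_iff forall_2)
      moreover have "?M *v ?v = \<mu> *s ?v"
        unfolding M \<mu> by (simp add: trS_def algebra_simps)
      ultimately show ?thesis unfolding eigenvalues_def by blast
    qed
  qed
qed

lemma steady_state:
  assumes "resid p = 0"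
  shows "geco2 a b c dt p = p" "geco2_jac p = mat 1 + slope *\<^sub>R A_mat a b c"
  using assms by (simp_all add: geco2_eq geco2_jac_def)

section \<open>Stability, convergence and instability\<close>

lemma isCont_growth:
  assumes "p \<in> pos_quadrant" "resid p = 0" "e > 0"
  shows "\<exists>\<eta>>0. \<forall>x. norm (x - p) < \<eta> \<longrightarrow>
    \<bar>\<bar>1 - trS * slope * damp x\<bar> - \<bar>1 - trS * slope\<bar>\<bar> < e"
proof -
  have "isCont (\<lambda>x. \<bar>1 - trS * slope * damp x\<bar>) p"
    by (intro continuous_intros isCont_damp assms)
  then show ?thesis
    using assms(3) damp_resid_0[OF assms(2)]
    unfolding continuous_at_eps_delta by (simp add: dist_norm)
qed

text \<open>The error in \<open>inv_lin\<close> is constant in time, while the residual shrinks by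
  \<rho> as long as the orbit stays where the growth factor is at most \<rho>. The resulting norm
  bound itself ensures this confinement, so one induction closes the argument.\<close>

lemma contracting_orbit:
  assumes "p \<in> pos_quadrant" "resid p = 0" "\<bar>1 - trS * slope\<bar> < 1"
  shows "\<exists>\<rho> \<eta>. 0 \<le> \<rho> \<and> \<rho> < 1 \<and> 0 < \<eta> \<and>
    (\<forall>y. norm (y - p) < \<eta> \<longrightarrow>
      (\<forall>n. norm ((geco2 a b c dt ^^ n) y - p)
        \<le> nconst * (\<bar>inv_lin (y - p)\<bar> + \<rho> ^ n * \<bar>resid y\<bar>)))"
proof -
  \<comment> \<open>The midpoint between the modulus of the stability function and 1 leaves room for
    the variation of \<open>damp\<close> near \<open>p\<close>.\<close>
  define \<rho> where "\<rho> = (1 + \<bar>1 - trS * slope\<bar>) / 2"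
  have \<rho>: "0 \<le> \<rho>" "\<rho> < 1" using assms(3) by (auto simp: \<rho>_def)
  obtain \<eta> where \<eta>: "0 < \<eta>"
    "\<And>x. norm (x - p) < \<eta> \<Longrightarrow> \<bar>1 - trS * slope * damp x\<bar> \<le> \<rho>"
  proof -
    have "(1 - \<bar>1 - trS * slope\<bar>) / 2 > 0" using assms(3) by simp
    from isCont_growth[OF assms(1,2) this] obtain \<eta> where "0 < \<eta>" and
      \<eta>: "\<And>x. norm (x - p) < \<eta> \<Longrightarrow>
        \<bar>\<bar>1 - trS * slope * damp x\<bar> - \<bar>1 - trS * slope\<bar>\<bar> < (1 - \<bar>1 - trS * slope\<bar>) / 2"
      by blast
    have "\<bar>1 - trS * slope * damp x\<bar> \<le> \<rho>" if "norm (x - p) < \<eta>" for x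
      using \<eta>[OF that] unfolding \<rho>_def abs_less_iff by argo
    with \<open>0 < \<eta>\<close> show thesis by (rule that)
  qed
  \<comment> \<open>\<open>K\<close> multiplies the norm bounds of the coordinate change and of its
    inverse; a start within \<open>\<eta> / K\<close> keeps the orbit within \<eta>.\<close>
  define K where "K = nconst * (a + b + 1 + c)"
  have K: "0 < K" using nconst_pos a_pos b_pos c_pos by (simp add: K_def)
  have bound: "norm ((geco2 a b c dt ^^ n) y - p)
      \<le> nconst * (\<bar>inv_lin (y - p)\<bar> + \<rho> ^ n * \<bar>resid y\<bar>)"
    if y: "norm (y - p) < \<eta> / K" for y n
  proof -
    let ?y = "\<lambda>n. (geco2 a b c dt ^^ n) y"
    have start: "nconst * (\<bar>inv_lin (y - p)\<bar> + \<bar>resid y\<bar>) < \<eta>"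
    proof -
      have "\<bar>inv_lin (y - p)\<bar> + \<bar>resid y\<bar> \<le> (a + b + 1 + c) * norm (y - p)"
        using inv_lin_resid_le_norm[of "y - p"] assms(2)
        by (simp add: resid_simps)
      then have "nconst * (\<bar>inv_lin (y - p)\<bar> + \<bar>resid y\<bar>) \<le> K * norm (y - p)"
        using nconst_pos by (simp add: K_def mult.assoc)
      also have "\<dots> < \<eta>" using y K by (simp add: field_simps)
      finally show ?thesis .
    qed
    have step: "norm (?y n - p) \<le> nconst * (\<bar>inv_lin (y - p)\<bar> + \<rho> ^ n * \<bar>resid y\<bar>)"
      if "\<bar>resid (?y n)\<bar> \<le> \<rho> ^ n * \<bar>resid y\<bar>" for n
    proof -
      have "norm (?y n - p) \<le> nconst * (\<bar>inv_lin (y - p)\<bar> + \<bar>resid (?y n)\<bar>)"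
        using norm_le_inv_lin_resid[of "?y n - p"] assms(2)
        by (simp add: resid_simps inv_lin_simps inv_lin_funpow)
      also have "\<dots> \<le> nconst * (\<bar>inv_lin (y - p)\<bar> + \<rho> ^ n * \<bar>resid y\<bar>)"
        using that nconst_pos by simp
      finally show ?thesis .
    qed
    have "\<bar>resid (?y n)\<bar> \<le> \<rho> ^ n * \<bar>resid y\<bar>"
    proof (induction n)
      case (Suc n)
      have "\<rho> ^ n * \<bar>resid y\<bar> \<le> 1 * \<bar>resid y\<bar>"
        using \<rho> by (intro mult_right_mono power_le_one) auto
      then have "nconst * (\<bar>inv_lin (y - p)\<bar> + \<rho> ^ n * \<bar>resid y\<bar>)
          \<le> nconst * (\<bar>inv_lin (y - p)\<bar> + \<bar>resid y\<bar>)"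
        using nconst_pos by simp
      with step[OF Suc] start have "norm (?y n - p) < \<eta>" by linarith
      from mult_right_mono[OF \<eta>(2)[OF this], of "\<bar>resid (?y n)\<bar>"]
      have "\<bar>resid (?y (Suc n))\<bar> \<le> \<rho> * \<bar>resid (?y n)\<bar>"
        by (simp add: resid_geco2 abs_mult)
      also have "\<dots> \<le> \<rho> * (\<rho> ^ n * \<bar>resid y\<bar>)"
        using Suc \<rho> by (intro mult_left_mono) auto
      finally show ?case by (simp add: mult.assoc)
    qed simp
    with step show ?thesis by blast
  qed
  then show ?thesis
    using \<rho> \<eta>(1) K by (intro exI[of _ \<rho>] exI[of _ "\<eta> / K"]) auto
qed

lemma stable_if_contracting:
  assumes "p \<in> pos_quadrant" "resid p = 0" "\<bar>1 - trS * slope\<bar> < 1"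
  shows "stable_fixed_point (geco2 a b c dt) pos_quadrant p"
  unfolding stable_fixed_point_def
proof (intro conjI allI impI)
  fix \<epsilon> :: real assume "0 < \<epsilon>"
  obtain \<rho> \<eta> where \<rho>: "0 \<le> \<rho>" "\<rho> < 1" and "0 < \<eta>" and
    bound: "\<And>y n. norm (y - p) < \<eta> \<Longrightarrow> norm ((geco2 a b c dt ^^ n) y - p)
        \<le> nconst * (\<bar>inv_lin (y - p)\<bar> + \<rho> ^ n * \<bar>resid y\<bar>)"
    using contracting_orbit[OF assms] by blast
  define K where "K = nconst * (a + b + 1 + c)"
  have K: "0 < K" using nconst_pos a_pos b_pos c_pos by (simp add: K_def)
  have "norm ((geco2 a b c dt ^^ n) y - p) < \<epsilon>" if "norm (y - p) < min \<eta> (\<epsilon> / K)" for y n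
  proof -
    have "\<rho> ^ n * \<bar>resid y\<bar> \<le> 1 * \<bar>resid y\<bar>"
      using \<rho> by (intro mult_right_mono power_le_one) auto
    then have "\<bar>inv_lin (y - p)\<bar> + \<rho> ^ n * \<bar>resid y\<bar> \<le> (a + b + 1 + c) * norm (y - p)"
      using inv_lin_resid_le_norm[of "y - p"] assms(2)
      by (simp add: resid_simps algebra_simps)
    then have "nconst * (\<bar>inv_lin (y - p)\<bar> + \<rho> ^ n * \<bar>resid y\<bar>) \<le> K * norm (y - p)"
      using nconst_pos by (simp add: K_def mult.assoc)
    also have "\<dots> < \<epsilon>" using that K by (simp add: field_simps)
    finally show ?thesis using bound[of y n] that by simp
  qed
  then show "\<exists>\<delta>>0. \<forall>y\<in>pos_quadrant. norm (y - p) < \<delta> \<longrightarrow>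
      (\<forall>n. norm ((geco2 a b c dt ^^ n) y - p) < \<epsilon>)"
    using \<open>0 < \<eta>\<close> \<open>0 < \<epsilon>\<close> K by (intro exI[of _ "min \<eta> (\<epsilon> / K)"]) auto
qed (use assms steady_state in auto)

lemma convergent_if_contracting:
  assumes "p \<in> pos_quadrant" "resid p = 0" "\<bar>1 - trS * slope\<bar> < 1"
  shows "\<exists>\<delta>>0. \<forall>y. inv_lin y = inv_lin p \<and> norm (y - p) < \<delta> \<longrightarrow>
    (\<lambda>n. (geco2 a b c dt ^^ n) y) \<longlonglongrightarrow> p"
proof -
  obtain \<rho> \<eta> where \<rho>: "0 \<le> \<rho>" "\<rho> < 1" and "0 < \<eta>" and
    bound: "\<And>y n. norm (y - p) < \<eta> \<Longrightarrow> norm ((geco2 a b c dt ^^ n) y - p)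
        \<le> nconst * (\<bar>inv_lin (y - p)\<bar> + \<rho> ^ n * \<bar>resid y\<bar>)"
    using contracting_orbit[OF assms] by blast
  have "(\<lambda>n. (geco2 a b c dt ^^ n) y) \<longlonglongrightarrow> p"
    if "inv_lin y = inv_lin p" "norm (y - p) < \<eta>" for y
  proof -
    have "(\<lambda>n. nconst * (\<rho> ^ n * \<bar>resid y\<bar>)) \<longlonglongrightarrow> nconst * (0 * \<bar>resid y\<bar>)"
      using \<rho> by (intro tendsto_intros LIMSEQ_realpow_zero) auto
    then have lim: "(\<lambda>n. nconst * (\<rho> ^ n * \<bar>resid y\<bar>)) \<longlonglongrightarrow> 0" by simp
    \<comment> \<open>Equal invariants remove the constant term of the orbit bound and leave only
      the geometric one.\<close>
    have "norm ((geco2 a b c dt ^^ n) y - p) \<le> nconst * (\<rho> ^ n * \<bar>resid y\<bar>)" for n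
      using bound[OF that(2), of n] that(1) by (simp add: inv_lin_simps)
    then have "(\<lambda>n. (geco2 a b c dt ^^ n) y - p) \<longlonglongrightarrow> 0"
      by (intro Lim_null_comparison[OF _ lim] always_eventually allI)
    then show ?thesis by (rule LIM_zero_cancel)
  qed
  with \<open>0 < \<eta>\<close> show ?thesis by blast
qed

text \<open>Under stability an orbit would stay where the growth factor is at least some
  \<open>\<rho> > 1\<close>. A nonzero initial residual would then grow geometrically, although
  confinement near \<open>p\<close> bounds it.\<close>

lemma unstable_if_expanding:
  assumes p: "p \<in> pos_quadrant" "resid p = 0" and "1 < \<bar>1 - trS * slope\<bar>"
  shows "unstable_fixed_point (geco2 a b c dt) pos_quadrant p"
  unfolding unstable_fixed_point_def
proof (intro conjI notI)
  assume stable: "stable_fixed_point (geco2 a b c dt) pos_quadrant p"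
  define \<rho> where "\<rho> = (1 + \<bar>1 - trS * slope\<bar>) / 2"
  have \<rho>: "1 < \<rho>" using assms(3) by (auto simp: \<rho>_def)
  obtain \<eta> where \<eta>: "0 < \<eta>"
    "\<And>x. norm (x - p) < \<eta> \<Longrightarrow> \<rho> \<le> \<bar>1 - trS * slope * damp x\<bar>"
  proof -
    have "(\<bar>1 - trS * slope\<bar> - 1) / 2 > 0" using assms(3) by simp
    from isCont_growth[OF assms(1,2) this] obtain \<eta> where "0 < \<eta>" and
      \<eta>: "\<And>x. norm (x - p) < \<eta> \<Longrightarrow>
        \<bar>\<bar>1 - trS * slope * damp x\<bar> - \<bar>1 - trS * slope\<bar>\<bar> < (\<bar>1 - trS * slope\<bar> - 1) / 2"
      by blast
    have "\<rho> \<le> \<bar>1 - trS * slope * damp x\<bar>" if "norm (x - p) < \<eta>" for x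
      using \<eta>[OF that] unfolding \<rho>_def abs_less_iff by argo
    with \<open>0 < \<eta>\<close> show thesis by (rule that)
  qed
  obtain \<delta> where \<delta>: "0 < \<delta>" "\<And>y n. y \<in> pos_quadrant \<Longrightarrow> norm (y - p) < \<delta> \<Longrightarrow>
      norm ((geco2 a b c dt ^^ n) y - p) < \<eta>"
    using stable \<eta>(1) unfolding stable_fixed_point_def by blast
  obtain r where r: "0 < r" "ball p r \<subseteq> pos_quadrant"
    using open_pos_quadrant p(1) by (meson openE)
  have dir: "0 < norm dir"
    using dir_nth(2) by (metis zero_index zero_less_norm_iff zero_neq_one)
  \<comment> \<open>Moving from \<open>p\<close> by \<open>t\<close> along \<open>dir\<close> gives
    residual \<open>- t * trS\<close>, hence nonzero. The factor 2 puts the point at distance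
    \<open>min \<delta> r / 2\<close>, strictly inside both balls.\<close>
  define t where "t = min \<delta> r / (2 * norm dir)"
  have t: "0 < t" using \<delta>(1) r(1) dir by (simp add: t_def)
  define y where "y = p + t *\<^sub>R dir"
  have "norm (y - p) = min \<delta> r / 2"
    using t dir by (simp add: y_def) (simp add: t_def)
  then have y: "norm (y - p) < \<delta>" "norm (y - p) < r"
    using \<delta>(1) r(1) by auto
  then have "y \<in> pos_quadrant"
    using r(2) by (auto simp: dist_norm norm_minus_commute)
  note near = \<delta>(2)[OF this y(1)]
  have "resid y \<noteq> 0"
    using t trS_pos p(2) by (simp add: y_def resid_simps)
  have grow: "\<rho> ^ n * \<bar>resid y\<bar> \<le> \<bar>resid ((geco2 a b c dt ^^ n) y)\<bar>" for n
  proof (induction n)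
    case (Suc n)
    let ?z = "(geco2 a b c dt ^^ n) y"
    have "\<rho> * (\<rho> ^ n * \<bar>resid y\<bar>) \<le> \<bar>1 - trS * slope * damp ?z\<bar> * \<bar>resid ?z\<bar>"
      using Suc \<eta>(2)[OF near[of n]] \<rho> by (intro mult_mono) auto
    then show ?case by (simp add: resid_geco2 abs_mult mult.assoc)
  qed simp
  obtain n where "(a + b) * \<eta> / \<bar>resid y\<bar> < \<rho> ^ n"
    using real_arch_pow[OF \<rho>] by blast
  then have "(a + b) * \<eta> < \<rho> ^ n * \<bar>resid y\<bar>"
    using \<open>resid y \<noteq> 0\<close> by (simp add: field_simps)
  also note grow[of n]
  also have "\<bar>resid ((geco2 a b c dt ^^ n) y)\<bar> \<le> (a + b) * norm ((geco2 a b c dt ^^ n) y - p)"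
    using resid_le_norm[of "(geco2 a b c dt ^^ n) y - p"] p(2) by (simp add: resid_simps)
  also have "\<dots> \<le> (a + b) * \<eta>"
    using near[of n] a_pos b_pos by (intro mult_left_mono) auto
  finally show False by simp
qed (use p steady_state in auto)

section \<open>Regularity near a positive point\<close>

lemma C1_on_nhd:
  assumes "p \<in> pos_quadrant"
  shows "\<exists>D. open D \<and> p \<in> D \<and> D \<subseteq> pos_quadrant \<and> C1_on (geco2 a b c dt) D \<and>
    (\<exists>L. L-lipschitz_on D (\<lambda>x. jacobian (geco2 a b c dt) (at x)))"
proof -
  \<comment> \<open>With half the smallest entry of \<open>p\<close> as radius, every entry stays at
    least \<open>m\<close> on the ball, which keeps the coordinate ratios Lipschitz.\<close>
  define m where "m = min (p $ 1) (p $ 2) / 2"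
  have m: "0 < m" "2 * m \<le> p $ i" for i
    using assms exhaust_2[of i] by (auto simp: m_def pos_quadrant_def)
  define D where "D = ball p m"
  have close: "\<bar>x $ i - p $ i\<bar> \<le> m" if "x \<in> D" for x i
    using component_le_norm_cart[of "x - p" i] that by (simp add: D_def dist_norm norm_minus_commute)
  have low: "m \<le> x $ i" if "x \<in> D" for x i
    using close[OF that, of i] m(2)[of i] by linarith
  have up: "x $ i \<le> norm p + m" if "x \<in> D" for x i
    using close[OF that, of i] component_le_norm_cart[of p i] by linarith
  have sub: "D \<subseteq> pos_quadrant"
    using less_le_trans[OF m(1) low] by (auto simp: pos_quadrant_def)
  obtain L where "L-lipschitz_on D geco2_jac"
    using lipschitz_on_geco2_jac[OF m(1) low up] m(1) by (auto simp: add_nonneg_nonneg)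
  then have L: "L-lipschitz_on D (\<lambda>x. jacobian (geco2 a b c dt) (at x))"
    by (rule lipschitz_on_transform) (use sub in \<open>auto simp: jacobian_geco2\<close>)
  have "C1_on (geco2 a b c dt) D"
    unfolding C1_on_def
    using lipschitz_on_continuous_on[OF L] has_derivative_geco2 sub
    by (auto simp: differentiable_def)
  then show ?thesis
    using L sub m(1) by (intro exI[of _ D]) (auto simp: D_def)
qed

end

theorem theorem7:
  fixes a b c dt :: real and ystar :: "real^2"
  assumes "0 < a" "0 < b" "0 < c" "0 < dt"
    and "ystar \<in> pos_quadrant" and "A_mat a b c *v ystar = 0"
  shows "(\<exists>D. open D \<and> ystar \<in> D \<and> D \<subseteq> pos_quadrant \<and> C1_on (geco2 a b c dt) D \<and>
            (\<exists>L. L-lipschitz_on D (\<lambda>x. jacobian (geco2 a b c dt) (at x)))) \<and>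
         trace (S_minus a b c) = a * c + b \<and>
         eigenvalues (jacobian (geco2 a b c dt) (at ystar)) =
           {1, complex_of_real (geco2_R a b c dt (- (dt * (a * c + b))))} \<and>
         (\<bar>geco2_R a b c dt (- (dt * (a * c + b)))\<bar> < 1 \<longrightarrow>
            stable_fixed_point (geco2 a b c dt) pos_quadrant ystar \<and>
            (\<exists>\<delta>>0. \<forall>y0\<in>pos_quadrant.
               vector [1, c] \<bullet> y0 = vector [1, c] \<bullet> ystar \<and> norm (y0 - ystar) < \<delta> \<longrightarrow>
               (\<lambda>n. (geco2 a b c dt ^^ n) y0) \<longlonglongrightarrow> ystar)) \<and>
         (1 < \<bar>geco2_R a b c dt (- (dt * (a * c + b)))\<bar> \<longrightarrow>
            unstable_fixed_point (geco2 a b c dt) pos_quadrant ystar)"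
proof -
  interpret geco2_params a b c dt
    using assms by unfold_locales
  \<comment> \<open>The second entry of \<open>dir\<close> is 1, so the second component of
    \<open>A\<close> applied to \<open>ystar\<close> is its residual.\<close>
  have "resid ystar = 0"
    using arg_cong[OF assms(6), of "\<lambda>x. x $ 2"] by (simp add: A_mat_mult dir_nth)
  note p = assms(5) this
  have inv: "vector [1, c] \<bullet> y = inv_lin y" for y
    by (simp add: inner_vec_def sum_2 inv_lin_def)
  show ?thesis
    unfolding inv
    using C1_on_nhd[OF p(1)] trace_S_minus eigenvalues_steady geco2_R_eq
      jacobian_geco2[OF p(1)] steady_state(2)[OF p(2)]
      stable_if_contracting[OF p] convergent_if_contracting[OF p] unstable_if_expanding[OF p]
    unfolding trS_def by simp blast
qed

end
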